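(* The polytope of magic labelings of the complete general graph $\mathcal{P}_{\Gamma_n}$ is an $n(n-1)/2$-dimensional rational polytope with the following description: $$\mathcal{P}_{\Gamma_n}=\Bigl\{L=(L(e_{ij}))\in\mathbb{R}^{\frac{n(n+1)}{2}} : L(e_{ij})\ge 0 \text{ for } 1\le i\le j\le n;\ \sum_{j=1}^{i}L(e_{ji})+\sum_{j=i+1}^{n}L(e_{ij})=1\text{ for } i=1,\dots,n\Bigr\}.$$ The $d$-dimensional faces of $\mathcal{P}_{\Gamma_n}$ are the $d$-dimensional polytopes of magic labelings of positive graphs with $n$ vertices and at most $n+d$ edges. There are $\binom{2n-1}{n}$ faces of $\mathcal{P}_{\Gamma_{2n}}$ that are copies of the Birkhoff polytope $B_n$.
   Context: $\Gamma_n$ is the complete general graph on vertices $v_1,\dots,v_n$: the complete graph together with one loop at every vertex; $e_{ij}$ ($i\le j$) is the edge between $v_i$ and $v_j$ ($e_{ii}$ the loop). A labeling of a graph $G$ assigns a nonnegative integer to each edge; it is a magic labeling of magic sum $r$ if at each vertex the labels of the incident edges sum to $r$ (a loop is counted once). $G$ is positive if for every edge $e$ there is a magic labeling $L$ of $G$ with $L(e)>0$. For a graph $G$ with $q$ edges, the polytope of magic labelings $\mathcal{P}_G\subseteq\mathbb{R}^q$ is the set of nonnegative real edge-labelings whose sum at every vertex is $1$ (loops counted once). Graphs with $n$ vertices here are subgraphs of $\Gamma_n$ with the full vertex set; for such a subgraph $H$, $\mathcal{P}_H$ is viewed inside $\mathcal{P}_{\Gamma_n}$ by labeling the missing edges $0$.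 Faces are nonempty. A polytope is rational if its vertices have rational coordinates. The Birkhoff polytope $B_n$ is the set of $n\times n$ nonnegative real matrices with all row and column sums $1$. It is identified with $\mathcal{P}_{K_{n,n}}$, where $K_{n,n}$ is the complete bipartite graph with parts of size $n$; "copies of $B_n$" among the faces of $\mathcal{P}_{\Gamma_{2n}}$ refers to the faces $\mathcal{P}_H$ with $H$ a subgraph of $\Gamma_{2n}$ isomorphic to $K_{n,n}$. *)

theory Defs
  imports "HOL-Analysis.Analysis" "HOL-Library.Uprod"
begin

(* A graph with possible loops on the vertex type 'v is its set of edges, an edge being an
   unordered pair of not necessarily distinct vertices: Upair x x is the loop at x.  The vertex
   set is always all of 'v, so the values of type "'v uprod set" are exactly the subgraphs with
   full vertex set of the complete general graph. *)

instance uprod :: (finite) finite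
  by standard simp

abbreviation complete_general_graph :: "'v uprod set" where
  "complete_general_graph \<equiv> UNIV"

(* Being a set, this contains a loop only once. *)
definition incident_edges :: "'v uprod set \<Rightarrow> 'v \<Rightarrow> 'v uprod set" where
  "incident_edges E v = {e \<in> E. v \<in> set_uprod e}"

(* Only the values of L on E matter. *)
definition magic_labeling :: "'v::finite uprod set \<Rightarrow> nat \<Rightarrow> ('v uprod \<Rightarrow> nat) \<Rightarrow> bool" where
  "magic_labeling E r L \<longleftrightarrow> (\<forall>v. (\<Sum>e\<in>incident_edges E v. L e) = r)"

definition positive_graph :: "'v::finite uprod set \<Rightarrow> bool" where
  "positive_graph E \<longleftrightarrow> (\<forall>e\<in>E. \<exists>r L. magic_labeling E r L \<and> L e > 0)"

(* The polytope of every graph lives in the coordinate space of the complete general graph;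
   edges missing from E are labeled 0. *)
definition magic_polytope :: "'v::finite uprod set \<Rightarrow> (real ^ 'v uprod) set" where
  "magic_polytope E =
     {L. (\<forall>e\<in>E. L $ e \<ge> 0) \<and> (\<forall>e. e \<notin> E \<longrightarrow> L $ e = 0) \<and>
         (\<forall>v. (\<Sum>e\<in>incident_edges E v. L $ e) = 1)}"

definition rational_polytope :: "(real ^ 'i::finite) set \<Rightarrow> bool" where
  "rational_polytope P \<longleftrightarrow>
     polytope P \<and> (\<forall>x. x extreme_point_of P \<longrightarrow> (\<forall>i. x $ i \<in> \<rat>))"

definition graph_isomorphism ::
    "('a \<Rightarrow> 'b) \<Rightarrow> 'a set \<Rightarrow> 'a uprod set \<Rightarrow> 'b set \<Rightarrow> 'b uprod set \<Rightarrow> bool" where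
  "graph_isomorphism f V E W F \<longleftrightarrow> bij_betw f V W \<and> map_uprod f ` E = F"

definition Knn_verts :: "nat \<Rightarrow> (nat + nat) set" where
  "Knn_verts m = Inl ` {..<m} \<union> Inr ` {..<m}"

definition Knn_edges :: "nat \<Rightarrow> (nat + nat) uprod set" where
  "Knn_edges m = {Upair (Inl i) (Inr j) |i j. i < m \<and> j < m}"

definition birkhoff_copy :: "nat \<Rightarrow> (real ^ 'v::finite uprod) set \<Rightarrow> bool" where
  "birkhoff_copy m F \<longleftrightarrow>
     (\<exists>H f. graph_isomorphism f (Knn_verts m) (Knn_edges m) UNIV H \<and> F = magic_polytope H)"

(* The Birkhoff polytope, with m x m matrices as functions vanishing outside the index range. *)
definition birkhoff_polytope :: "nat \<Rightarrow> (nat \<Rightarrow> nat \<Rightarrow> real) set" where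
  "birkhoff_polytope m =
     {M. (\<forall>i<m. \<forall>j<m. M i j \<ge> 0) \<and> (\<forall>i j. \<not> (i < m \<and> j < m) \<longrightarrow> M i j = 0) \<and>
         (\<forall>i<m. (\<Sum>j<m. M i j) = 1) \<and> (\<forall>j<m. (\<Sum>i<m. M i j) = 1)}"

(* Justifies birkhoff_copy: reading off coordinates identifies magic_polytope H with the
   Birkhoff polytope whenever H is isomorphic to the complete bipartite graph. *)
lemma magic_polytope_birkhoff:
  fixes H :: "'v::finite uprod set"
  assumes iso: "graph_isomorphism f (Knn_verts m) (Knn_edges m) UNIV H"
  shows "bij_betw (\<lambda>L i j. if i < m \<and> j < m then L $ Upair (f (Inl i)) (f (Inr j)) else 0)
           (magic_polytope H) (birkhoff_polytope m)"
proof -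
  define u where "u = (\<lambda>(i, j). Upair (f (Inl i)) (f (Inr j)))"
  let ?I = "{..<m} \<times> {..<m}"
  have inj: "inj_on f (Knn_verts m)" and sur: "f ` Knn_verts m = UNIV"
    using iso by (auto simp: graph_isomorphism_def bij_betw_def)
  have fLL: "f (Inl i) = f (Inl i') \<longleftrightarrow> i = i'" and fRR: "f (Inr i) = f (Inr i') \<longleftrightarrow> i = i'"
    and fLR: "f (Inl i) \<noteq> f (Inr i')" and fRL: "f (Inr i) \<noteq> f (Inl i')"
    if "i < m" "i' < m" for i i'
    using that inj by (auto simp: Knn_verts_def inj_on_def)
  have "Knn_edges m = (\<lambda>(i, j). Upair (Inl i) (Inr j)) ` ?I"
    by (auto simp: Knn_edges_def)
  moreover have "H = map_uprod f ` Knn_edges m"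
    using iso by (simp add: graph_isomorphism_def)
  ultimately have H: "H = u ` ?I"
    by (simp add: image_image u_def case_prod_beta)
  have inju: "inj_on u ?I"
    by (auto simp: inj_on_def u_def fLL fRR fLR fRL)
  have inc: "incident_edges H x = u ` {p \<in> ?I. x \<in> set_uprod (u p)}" for x
    by (auto simp: incident_edges_def H)
  have incL: "incident_edges H (f (Inl i)) = u ` ({i} \<times> {..<m})" if "i < m" for i
    unfolding inc by (rule arg_cong[where f = "image u"])
      (use that in \<open>auto simp: u_def fLL fLR\<close>)
  have incR: "incident_edges H (f (Inr j)) = u ` ({..<m} \<times> {j})" if "j < m" for j
    unfolding inc by (rule arg_cong[where f = "image u"])
      (use that in \<open>auto simp: u_def fRR fRL\<close>)
  have sumL: "(\<Sum>e\<in>incident_edges H (f (Inl i)). L $ e) = (\<Sum>j<m. L $ u (i, j))"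
    if "i < m" for i and L :: "real ^ 'v uprod"
  proof -
    have "inj_on u ({i} \<times> {..<m})" by (rule inj_on_subset[OF inju]) (use that in auto)
    moreover have "{i} \<times> {..<m} = Pair i ` {..<m}" by auto
    ultimately show ?thesis
      unfolding incL[OF that] by (simp add: sum.reindex inj_on_def)
  qed
  have sumR: "(\<Sum>e\<in>incident_edges H (f (Inr j)). L $ e) = (\<Sum>i<m. L $ u (i, j))"
    if "j < m" for j and L :: "real ^ 'v uprod"
  proof -
    have "inj_on u ({..<m} \<times> {j})" by (rule inj_on_subset[OF inju]) (use that in auto)
    moreover have "{..<m} \<times> {j} = (\<lambda>i. (i, j)) ` {..<m}" by auto
    ultimately show ?thesis
      unfolding incR[OF that] by (simp add: sum.reindex inj_on_def)
  qed
  have allv: "(\<forall>v. P v) \<longleftrightarrow> (\<forall>i<m. P (f (Inl i))) \<and> (\<forall>j<m. P (f (Inr j)))" for P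
  proof -
    have "(\<forall>v. P v) \<longleftrightarrow> (\<forall>v\<in>f ` Knn_verts m. P v)" using sur by simp
    then show ?thesis by (auto simp: Knn_verts_def)
  qed
  have poly: "magic_polytope H = {L. (\<forall>i<m. \<forall>j<m. L $ u (i, j) \<ge> 0) \<and> (\<forall>e. e \<notin> H \<longrightarrow> L $ e = 0) \<and>
     (\<forall>i<m. (\<Sum>j<m. L $ u (i, j)) = 1) \<and> (\<forall>j<m. (\<Sum>i<m. L $ u (i, j)) = 1)}"
  proof -
    have "(\<forall>e\<in>H. L $ e \<ge> 0) \<longleftrightarrow> (\<forall>i<m. \<forall>j<m. L $ u (i, j) \<ge> 0)" for L :: "real ^ 'v uprod"
      by (auto simp: H)
    then show ?thesis
      unfolding magic_polytope_def allv by (simp add: sumL sumR cong: conj_cong)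
  qed
  let ?g = "\<lambda>M. \<chi> e. if e \<in> H then case_prod M (inv_into ?I u e) else 0"
  have g: "?g M $ u (i, j) = M i j" if "i < m" "j < m" for M :: "nat \<Rightarrow> nat \<Rightarrow> real" and i j
    using that inju by (simp add: H)
  have uu: "Upair (f (Inl i)) (f (Inr j)) = u (i, j)" for i j
    by (simp add: u_def)
  show ?thesis
    unfolding uu
  proof (rule bij_betw_byWitness[where f' = ?g])
    show "\<forall>L\<in>magic_polytope H. ?g (\<lambda>i j. if i < m \<and> j < m then L $ u (i, j) else 0) = L"
    proof (intro ballI vec_eq_iff[THEN iffD2] allI)
      fix L e assume L: "L \<in> magic_polytope H"
      show "?g (\<lambda>i j. if i < m \<and> j < m then L $ u (i, j) else 0) $ e = L $ e"
      proof (cases "e \<in> H")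
        case True
        then obtain i j where e: "e = u (i, j)" "i < m" "j < m" by (auto simp: H)
        show ?thesis unfolding e(1) g[OF e(2,3)] using e by simp
      next
        case False
        then show ?thesis using L by (simp add: poly)
      qed
    qed
    show "\<forall>M\<in>birkhoff_polytope m. (\<lambda>i j. if i < m \<and> j < m then ?g M $ u (i, j) else 0) = M"
      using g by (auto simp: birkhoff_polytope_def fun_eq_iff simp del: vec_lambda_beta)
    show "(\<lambda>L i j. if i < m \<and> j < m then L $ u (i, j) else 0) ` magic_polytope H
            \<subseteq> birkhoff_polytope m"
      by (auto simp: birkhoff_polytope_def poly)
    show "?g ` birkhoff_polytope m \<subseteq> magic_polytope H"
    proof safe
      fix M assume M: "M \<in> birkhoff_polytope m"
      show "?g M \<in> magic_polytope H"
        unfolding poly using M g[of _ _ M]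
        by (simp add: birkhoff_polytope_def del: vec_lambda_beta) simp
    qed
  qed
qed

end

theory Submission
  imports Defs
begin

text \<open>
  Every face contains a point whose support is as large as possible; this point can be pushed beyond
  itself away from any point of the polytope supported on the same graph \<open>H\<close>, so the face is the
  polytope of \<open>H\<close>. Around such a point the polytope looks like the space of labelings on \<open>H\<close> with
  all vertex sums zero, which is cut out of a space of dimension \<open>card H\<close> by \<open>n\<close> equations; the
  equations are independent for the complete general graph because of the loops.
  A vertex is the only labeling with magic sum 1 on its support. Applying a \<open>\<rat>\<close>-linear retraction
  of \<open>\<real>\<close> onto \<open>\<rat>\<close> to its entries gives another one, so the vertex is rational; clearing
  denominators then gives the integer labelings that make \<open>H\<close> positive.
  The faces that are copies of the Birkhoff polytope correspond to the unordered partitions of the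
  vertices into two halves, that is, to the halves that avoid one fixed vertex.
\<close>

section \<open>Tools: a rational retraction, common denominators, points of maximal support\<close>

text \<open>Over the rationals, \<open>{1}\<close> is an independent subset of the reals, so
  prescribing the value 1 at 1 extends to a linear map. Additivity and the value at 1 are enough to
  transport vertex sums equal to 1.\<close>

lemma ex_additive_rat_retraction:
  "\<exists>\<phi>::real \<Rightarrow> rat. (\<forall>x y. \<phi> (x + y) = \<phi> x + \<phi> y) \<and> \<phi> 1 = 1"
proof -
  interpret vs: vector_space_pair "\<lambda>q x. of_rat q * (x::real)" "\<lambda>q x. q * (x::rat)"
    by unfold_locales (auto simp: algebra_simps of_rat_add of_rat_mult)
  have "vs.vs1.independent {1}"
    by (simp add: vs.vs1.independent_insert)
  then show ?thesis
    using vs.linear_construct[of "{1}" "\<lambda>_. 1"] vs.construct_basis[of "{1}" 1 "\<lambda>_. 1"]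
    by (auto simp: Vector_Spaces.linear_iff)
qed

lemma common_denominator:
  fixes f :: "'a \<Rightarrow> real"
  assumes "finite A" "\<And>a. a \<in> A \<Longrightarrow> f a \<in> \<rat>"
  shows "\<exists>N::nat. N > 0 \<and> (\<forall>a\<in>A. real N * f a \<in> \<int>)"
  using assms
proof (induction A rule: finite_induct)
  case empty
  show ?case by (rule exI[of _ 1]) simp
next
  case (insert a A)
  then obtain N :: nat where N: "N > 0" "\<forall>a\<in>A. real N * f a \<in> \<int>"
    by auto
  have "f a \<in> \<rat>"
    using insert by auto
  then obtain p q where q: "q > 0" "f a = of_int p / of_int q"
    by (rule Rats_cases') auto
  have "real (nat q * N) * f b \<in> \<int>" if "b \<in> insert a A" for b
  proof (cases "b \<in> A")
    case True
    then have "of_int q * (real N * f b) \<in> \<int>"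
      using N by (intro Ints_mult[OF Ints_of_int]) auto
    then show ?thesis using q by (simp add: mult.assoc)
  next
    case False
    then have "real (nat q * N) * f b = of_int (p * int N)"
      using that q by simp
    then show ?thesis by (metis Ints_of_int)
  qed
  moreover have "nat q * N > 0"
    using q N by simp
  ultimately show ?case by blast
qed

text \<open>Choose for each coordinate a point positive there, if one exists, and average the
  choices: nonnegativity prevents cancellation.\<close>

lemma convex_ex_maximal_support:
  fixes C :: "(real ^ 'i::finite) set"
  assumes "convex C" "C \<noteq> {}" and nonneg: "\<And>L i. L \<in> C \<Longrightarrow> L $ i \<ge> 0"
  obtains x where "x \<in> C" "\<And>L i. L \<in> C \<Longrightarrow> L $ i > 0 \<Longrightarrow> x $ i > 0"
proof -
  obtain c where c: "c \<in> C"
    using assms by auto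
  \<comment> \<open>If no point of \<open>C\<close> is positive at \<open>i\<close>, the default
    \<open>c\<close> satisfies the condition vacuously.\<close>
  have "\<exists>x. x \<in> C \<and> (\<forall>L\<in>C. L $ i > 0 \<longrightarrow> x $ i > 0)" for i
    using c by blast
  then obtain f where f: "\<And>i. f i \<in> C" "\<And>i L. L \<in> C \<Longrightarrow> L $ i > 0 \<Longrightarrow> f i $ i > 0"
    by metis
  let ?x = "\<Sum>i\<in>UNIV. (1 / real CARD('i)) *\<^sub>R f i"
  show ?thesis
  proof
    show "?x \<in> C"
      by (rule convex_sum) (use assms f in auto)
    fix L i
    assume "L \<in> C" "L $ i > 0"
    then have "0 < (1 / real CARD('i)) * f i $ i"
      using f by simp
    also have "\<dots> \<le> (\<Sum>j\<in>UNIV. (1 / real CARD('i)) * f j $ i)"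
      using nonneg f(1)
      by (intro member_le_sum[of i UNIV "\<lambda>j. (1 / real CARD('i)) * f j $ i"]) auto
    finally show "?x $ i > 0"
      by simp
  qed
qed

section \<open>Labelings with zero vertex sums and the rank of the incidence matrix\<close>

lemma dim_coordinate_subspace:
  fixes H :: "'i::finite set"
  shows "dim {z::real^'i. \<forall>i. i \<notin> H \<longrightarrow> z $ i = 0} = card H"
proof -
  let ?B = "(\<lambda>i. axis i 1 :: real^'i) ` H"
  have "dim {z::real^'i. \<forall>b\<in>Basis. b \<notin> ?B \<longrightarrow> z \<bullet> b = 0} = card ?B"
    by (rule dim_substandard) (auto simp: Basis_vec_def)
  also have "{z::real^'i. \<forall>b\<in>Basis. b \<notin> ?B \<longrightarrow> z \<bullet> b = 0} = {z. \<forall>i. i \<notin> H \<longrightarrow> z $ i = 0}"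
    by (auto simp: Basis_vec_def inner_axis axis_eq_axis)
  also have "card ?B = card H"
    by (rule card_image) (auto simp: inj_on_def axis_eq_axis)
  finally show ?thesis .
qed

text \<open>The row of \<open>v\<close> in the vertex-edge incidence matrix of \<open>H\<close>, so
  that vertex sums become inner products and the rank becomes the dimension of a span.\<close>

definition star_vector :: "'v::finite uprod set \<Rightarrow> 'v \<Rightarrow> real ^ 'v uprod" where
  "star_vector H v = (\<chi> e. if e \<in> incident_edges H v then 1 else 0)"

lemma star_vector_inner: "star_vector H v \<bullet> z = (\<Sum>e\<in>incident_edges H v. z $ e)"
  by (simp add: star_vector_def inner_vec_def if_distrib[where f = "\<lambda>c. c * _"] sum.If_cases)

text \<open>The kernel of the incidence matrix, which contains every difference of two points of the
  polytope.\<close>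

definition magic_kernel :: "'v::finite uprod set \<Rightarrow> (real ^ 'v uprod) set" where
  "magic_kernel H =
     {z. (\<forall>e. e \<notin> H \<longrightarrow> z $ e = 0) \<and> (\<forall>v. (\<Sum>e\<in>incident_edges H v. z $ e) = 0)}"

lemma subspace_magic_kernel: "subspace (magic_kernel H)"
  by (auto simp: subspace_def magic_kernel_def sum.distrib simp flip: sum_distrib_left)

text \<open>Rank-nullity: inside the space of labelings supported on \<open>H\<close>, the kernel is
  the orthogonal complement of the star vectors.\<close>

lemma dim_magic_kernel: "dim (magic_kernel H) + dim (range (star_vector H)) = card H"
proof -
  let ?B = "{z::real^'a uprod. \<forall>e. e \<notin> H \<longrightarrow> z $ e = 0}"
  have B: "subspace ?B"
    by (auto simp: subspace_def)
  have sub: "range (star_vector H) \<subseteq> ?B"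
    by (auto simp: star_vector_def incident_edges_def)
  have "magic_kernel H = {y\<in>?B. \<forall>x\<in>range (star_vector H). orthogonal x y}"
    by (auto simp: magic_kernel_def orthogonal_def star_vector_inner)
  \<comment> \<open>The dimension formula for orthogonal complements is applied to subspaces, so the
    star vectors are replaced by their span.\<close>
  also have "\<dots> = {y\<in>?B. \<forall>x\<in>span (range (star_vector H)). orthogonal x y}"
  proof safe
    fix y x
    assume "\<forall>x\<in>range (star_vector H). orthogonal x y" "x \<in> span (range (star_vector H))"
    then show "orthogonal x y"
      by (metis orthogonal_commute orthogonal_to_span)
  qed (simp add: span_base)
  finally show ?thesis
    using dim_subspace_orthogonal_to_vectors[OF subspace_span B span_minimal[OF sub B]]
    by (simp add: dim_coordinate_subspace)
qed

lemma dim_range_star_vector_le: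
  fixes H :: "'v::finite uprod set"
  shows "dim (range (star_vector H)) \<le> CARD('v)"
  using dim_le_card'[of "range (star_vector H)"] card_image_le[of UNIV "star_vector H"] by simp

text \<open>Each loop meets exactly one vertex, so reading off the loop coordinates sends the star
  vectors to the standard basis; the rank is therefore full.\<close>

lemma dim_range_star_vector_UNIV:
  "dim (range (star_vector (UNIV :: 'v::finite uprod set))) = CARD('v)"
proof (rule antisym[OF dim_range_star_vector_le])
  let ?S = "range (star_vector (UNIV :: 'v uprod set))"
  let ?f = "\<lambda>L::real^'v uprod. \<chi> v. L $ Upair v v"
  have lin: "linear ?f"
    by (auto simp: linear_iff vec_eq_iff)
  have "?f (star_vector UNIV v) = axis v 1" for v :: 'v
    by (auto simp: vec_eq_iff star_vector_def incident_edges_def axis_def)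
  then have "?f ` ?S = range (\<lambda>v. axis v 1)"
    by (simp add: image_image)
  also have "\<dots> = (Basis :: (real^'v) set)"
    by (auto simp: Basis_vec_def)
  finally have "?f ` ?S = (Basis :: (real^'v) set)" .
  then have "dim (?f ` ?S) = DIM(real^'v)"
    by (metis dim_UNIV dim_span span_Basis)
  with dim_image_le[OF lin, of ?S] show "CARD('v) \<le> dim ?S"
    by simp
qed

section \<open>Perturbing a labeling, and the dimension of the polytope\<close>

text \<open>Kernel directions preserve the vertex sums, so only nonnegativity can fail. Zero entries
  of \<open>x\<close> stay fixed, and the finitely many positive ones leave room in both
  directions.\<close>

lemma magic_polytope_add_kernel:
  assumes x: "x \<in> magic_polytope H" and z: "z \<in> magic_kernel H"
    and supp: "\<And>e. x $ e = 0 \<Longrightarrow> z $ e = 0"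
  obtains \<epsilon> where "\<epsilon> > 0" "\<And>t. \<bar>t\<bar> \<le> \<epsilon> \<Longrightarrow> x + t *\<^sub>R z \<in> magic_polytope H"
proof -
  have x0: "x $ e \<ge> 0" for e
    using x by (cases "e \<in> H") (auto simp: magic_polytope_def)
  \<comment> \<open>Each quotient is the step length at which entry \<open>e\<close> can first reach
    0; the extra 1 keeps the set nonempty when \<open>z = 0\<close>.\<close>
  define \<epsilon> where "\<epsilon> = Min (insert 1 ((\<lambda>e. x $ e / \<bar>z $ e\<bar>) ` {e. z $ e \<noteq> 0}))"
  have "\<epsilon> > 0"
    unfolding \<epsilon>_def
  proof (subst Min_gr_iff)
    have "x $ e > 0" if "z $ e \<noteq> 0" for e
      using supp[of e] x0[of e] that by (metis order_less_le)
    then show "\<forall>a\<in>insert 1 ((\<lambda>e. x $ e / \<bar>z $ e\<bar>) ` {e. z $ e \<noteq> 0}). 0 < a"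
      by auto
  qed auto
  moreover have "x + t *\<^sub>R z \<in> magic_polytope H" if t: "\<bar>t\<bar> \<le> \<epsilon>" for t
  proof -
    have "x $ e + t * z $ e \<ge> 0" for e
    proof (cases "z $ e = 0")
      case False
      then have "\<epsilon> \<le> x $ e / \<bar>z $ e\<bar>"
        unfolding \<epsilon>_def by (intro Min_le) auto
      with t have "\<bar>t\<bar> \<le> x $ e / \<bar>z $ e\<bar>"
        by simp
      then have "\<bar>t * z $ e\<bar> \<le> x $ e"
        using False by (simp add: field_simps abs_mult)
      then show ?thesis by linarith
    qed (use x0 in simp)
    then show ?thesis
      using x z by (auto simp: magic_polytope_def magic_kernel_def sum.distrib
          simp flip: sum_distrib_left)
  qed
  ultimately show ?thesis
    using that by blast
qed

lemma magic_polytope_diff_kernel: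
  "\<lbrakk>x \<in> magic_polytope H; y \<in> magic_polytope H\<rbrakk> \<Longrightarrow> x - y \<in> magic_kernel H"
  by (auto simp: magic_polytope_def magic_kernel_def sum_subtractf)

text \<open>The polytope lies in the translate of the kernel through \<open>x\<close>. As
  \<open>x\<close> is positive on all of \<open>H\<close>, every kernel direction can be followed a
  little way inside the polytope, so this translate is the affine hull.\<close>

lemma aff_dim_magic_polytope:
  assumes x: "x \<in> magic_polytope H" and pos: "\<And>e. e \<in> H \<Longrightarrow> x $ e > 0"
  shows "aff_dim (magic_polytope H) = int (dim (magic_kernel H))"
proof -
  have "magic_polytope H \<subseteq> (+) x ` magic_kernel H"
  proof
    fix y assume "y \<in> magic_polytope H"
    then have "y - x \<in> magic_kernel H"
      using x by (intro magic_polytope_diff_kernel)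
    then show "y \<in> (+) x ` magic_kernel H"
      by (rule rev_image_eqI) simp
  qed
  then have "aff_dim (magic_polytope H) \<le> aff_dim ((+) x ` magic_kernel H)"
    by (rule aff_dim_subset)
  moreover have "(+) x ` magic_kernel H \<subseteq> affine hull (magic_polytope H)"
  proof safe
    fix z assume z: "z \<in> magic_kernel H"
    have "z $ e = 0" if "x $ e = 0" for e
      using pos[of e] z that by (cases "e \<in> H") (auto simp: magic_kernel_def)
    then obtain \<epsilon> where \<epsilon>: "\<epsilon> > 0" "x + \<epsilon> *\<^sub>R z \<in> magic_polytope H"
      using magic_polytope_add_kernel[OF x z] by (metis abs_of_pos order_refl)
    \<comment> \<open>Stretching the short feasible displacement by \<open>1 / \<epsilon>\<close>
      reaches \<open>x + z\<close>, which may leave the polytope but not its affine hull.\<close>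
    have "x + (1 / \<epsilon>) *\<^sub>R ((x + \<epsilon> *\<^sub>R z) - x) \<in> affine hull (magic_polytope H)"
      by (intro mem_affine_3_minus) (use x \<epsilon> in \<open>auto intro: hull_inc\<close>)
    then show "x + z \<in> affine hull (magic_polytope H)"
      using \<epsilon> by simp
  qed
  then have "aff_dim ((+) x ` magic_kernel H) \<le> aff_dim (magic_polytope H)"
    by (metis aff_dim_affine_hull aff_dim_subset)
  ultimately show ?thesis
    by (simp add: aff_dim_translation_eq aff_dim_subspace subspace_magic_kernel)
qed

section \<open>Rationality of the vertices\<close>

lemma extreme_point_magic_polytope_Rats:
  assumes ext: "x extreme_point_of (magic_polytope H)"
  shows "x $ e \<in> \<rat>"
proof -
  obtain \<phi> :: "real \<Rightarrow> rat" where add: "\<And>a b. \<phi> (a + b) = \<phi> a + \<phi> b" and one: "\<phi> 1 = 1"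
    using ex_additive_rat_retraction by blast
  have zero: "\<phi> 0 = 0"
    using add[of 0 0] by simp
  have sum: "\<phi> (sum f A) = (\<Sum>a\<in>A. \<phi> (f a))" for f and A :: "'a uprod set"
    by (induction A rule: infinite_finite_induct) (auto simp: add zero)
  have x: "x \<in> magic_polytope H"
    using ext by (simp add: extreme_point_of_def)
  \<comment> \<open>The image of \<open>x\<close> under \<open>\<phi>\<close> may have negative
    entries and so lie outside the polytope. It still has vertex sums 1 and vanishes where
    \<open>x\<close> does, so the direction \<open>z\<close> towards it is an admissible
    perturbation, and extremality forces \<open>z = 0\<close>.\<close>
  define z where "z = (\<chi> e. of_rat (\<phi> (x $ e))) - x"
  have "(\<Sum>a\<in>incident_edges H v. real_of_rat (\<phi> (x $ a))) = 1" for v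
    using x one by (simp add: magic_polytope_def flip: sum of_rat_sum)
  then have z: "z \<in> magic_kernel H"
    using x by (auto simp: z_def magic_kernel_def magic_polytope_def sum_subtractf zero)
  obtain \<epsilon> where \<epsilon>: "\<epsilon> > 0" "\<And>t. \<bar>t\<bar> \<le> \<epsilon> \<Longrightarrow> x + t *\<^sub>R z \<in> magic_polytope H"
    using magic_polytope_add_kernel[OF x z] by (auto simp: z_def zero)
  have mem: "x - \<epsilon> *\<^sub>R z \<in> magic_polytope H" "x + \<epsilon> *\<^sub>R z \<in> magic_polytope H"
    using \<epsilon>(2)[of "-\<epsilon>"] \<epsilon>(2)[of \<epsilon>] \<epsilon>(1) by simp_all
  have mid: "midpoint (x - \<epsilon> *\<^sub>R z) (x + \<epsilon> *\<^sub>R z) = x"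
    by (simp add: midpoint_def scaleR_2[symmetric])
  have "z = 0"
  proof (rule ccontr)
    assume "z \<noteq> 0"
    then have "x - \<epsilon> *\<^sub>R z \<noteq> x + \<epsilon> *\<^sub>R z"
      using \<epsilon>(1) by (simp add: algebra_simps flip: scaleR_2)
    then have "x \<in> open_segment (x - \<epsilon> *\<^sub>R z) (x + \<epsilon> *\<^sub>R z)"
      using mid midpoint_in_open_segment by metis
    then show False
      using ext mem by (auto simp: extreme_point_of_def)
  qed
  then have "x $ e = of_rat (\<phi> (x $ e))"
    by (simp add: z_def vec_eq_iff)
  then show ?thesis
    by (metis Rats_of_rat)
qed

section \<open>Polytopes of subgraphs as faces, and faces as polytopes of positive graphs\<close>

lemma magic_polytope_bounds:
  assumes "x \<in> magic_polytope H"
  shows "0 \<le> x $ e" "x $ e \<le> 1"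
proof -
  show *: "0 \<le> x $ e" for e
    using assms by (cases "e \<in> H") (auto simp: magic_polytope_def)
  obtain v where v: "v \<in> set_uprod e"
    by (cases e) auto
  show "x $ e \<le> 1"
  proof (cases "e \<in> H")
    case True
    then have "x $ e \<le> (\<Sum>a\<in>incident_edges H v. x $ a)"
      using v * by (intro member_le_sum) (auto simp: incident_edges_def)
    then show ?thesis
      using assms by (simp add: magic_polytope_def)
  qed (use assms in \<open>simp add: magic_polytope_def\<close>)
qed

text \<open>A finite intersection of halfspaces and hyperplanes, contained in the unit cube.\<close>

lemma polytope_magic_polytope: "polytope (magic_polytope H)"
proof -
  have "magic_polytope H = (\<Inter>e\<in>H. {x. axis e 1 \<bullet> x \<ge> 0}) \<inter>
      (\<Inter>e\<in>-H. {x. axis e 1 \<bullet> x = 0}) \<inter> (\<Inter>v. {x. star_vector H v \<bullet> x = 1})"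
    by (auto simp: magic_polytope_def star_vector_inner inner_axis')
  moreover have "polyhedron \<dots>"
    by (intro polyhedron_Int polyhedron_Inter)
      (auto intro: polyhedron_halfspace_ge polyhedron_hyperplane)
  moreover have "magic_polytope H \<subseteq> cbox 0 1"
    by (auto simp: mem_box_cart magic_polytope_bounds)
  then have "bounded (magic_polytope H)"
    using bounded_cbox bounded_subset by blast
  ultimately show ?thesis
    by (simp add: polytope_eq_bounded_polyhedron)
qed

text \<open>The total label outside \<open>H\<close> is a linear functional that is nonnegative on
  the large polytope and zero exactly on the small one, so its zero set is a supporting
  hyperplane.\<close>

lemma magic_polytope_face: "magic_polytope H face_of magic_polytope UNIV"
proof -
  let ?a = "(\<chi> e. if e \<in> H then 0 else 1) :: real^'a uprod"
  have inner: "?a \<bullet> x = (\<Sum>e\<in>-H. x $ e)" for x :: "real^'a uprod"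
    by (simp add: inner_vec_def if_distrib[where f = "\<lambda>c. c * _"] sum.If_cases)
  have inc: "(\<Sum>e\<in>incident_edges UNIV v. x $ e) = (\<Sum>e\<in>incident_edges H v. x $ e)"
    if "\<And>e. e \<notin> H \<Longrightarrow> x $ e = 0" for v and x :: "real^'a uprod"
    by (rule sum.mono_neutral_right) (use that in \<open>auto simp: incident_edges_def\<close>)
  have eq: "magic_polytope H = magic_polytope UNIV \<inter> {x. ?a \<bullet> x = 0}"
  proof (intro set_eqI iffI)
    fix x assume x: "x \<in> magic_polytope H"
    then show "x \<in> magic_polytope UNIV \<inter> {x. ?a \<bullet> x = 0}"
      using magic_polytope_bounds(1)[OF x] inc[of x]
      by (auto simp: magic_polytope_def inner)
  next
    fix x assume x: "x \<in> magic_polytope UNIV \<inter> {x. ?a \<bullet> x = 0}"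
    then have x0: "x $ e \<ge> 0" for e
      by (auto intro: magic_polytope_bounds)
    then have "x $ e = 0" if "e \<notin> H" for e
      using x that by (simp add: inner sum_nonneg_eq_0_iff)
    then show "x \<in> magic_polytope H"
      using x inc[of x] by (auto simp: magic_polytope_def)
  qed
  show ?thesis
    unfolding eq
  proof (rule face_of_Int_supporting_hyperplane_ge)
    show "convex (magic_polytope (UNIV :: 'a uprod set))"
      by (intro polytope_imp_convex polytope_magic_polytope)
    show "0 \<le> ?a \<bullet> x" if "x \<in> magic_polytope UNIV" for x :: "real^'a uprod"
      unfolding inner by (intro sum_nonneg magic_polytope_bounds[OF that])
  qed
qed

text \<open>The polytope is the convex hull of its vertices, so an edge on which \<open>x\<close> is
  positive is positive at some vertex as well. That vertex is rational, and a multiple of it is an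
  integer magic labeling.\<close>

lemma positive_graph_of_positive_point:
  assumes x: "x \<in> magic_polytope H" and pos: "\<And>e. e \<in> H \<Longrightarrow> x $ e > 0"
  shows "positive_graph H"
  unfolding positive_graph_def
proof
  fix e assume e: "e \<in> H"
  have "\<exists>y. y extreme_point_of (magic_polytope H) \<and> y $ e > 0"
  proof (rule ccontr)
    assume "\<not> ?thesis"
    then have "{y. y extreme_point_of (magic_polytope H)} \<subseteq> {y. axis e 1 \<bullet> y \<le> 0}"
      by (auto simp: inner_axis' not_less)
    then have "convex hull {y. y extreme_point_of (magic_polytope H)} \<subseteq> {y. axis e 1 \<bullet> y \<le> 0}"
      by (intro hull_minimal convex_halfspace_le)
    moreover have "magic_polytope H = convex hull {y. y extreme_point_of (magic_polytope H)}"
      by (intro Krein_Milman_Minkowski polytope_imp_compact polytope_imp_convex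
          polytope_magic_polytope)
    ultimately have "x $ e \<le> 0"
      using x by (auto simp: inner_axis')
    with pos[OF e] show False by simp
  qed
  then obtain y where ext: "y extreme_point_of (magic_polytope H)" and ye: "y $ e > 0"
    by blast
  then have y: "y \<in> magic_polytope H"
    by (simp add: extreme_point_of_def)
  \<comment> \<open>The common denominator \<open>N\<close> becomes the magic sum.\<close>
  obtain N :: nat where N: "N > 0" "\<And>a. real N * y $ a \<in> \<int>"
    using common_denominator[of UNIV "\<lambda>a. y $ a"] extreme_point_magic_polytope_Rats[OF ext]
    by auto
  \<comment> \<open>The scaled entries are already nonnegative integers; \<open>nat\<close> and the
    floor only change the type.\<close>
  define L where "L a = nat \<lfloor>real N * y $ a\<rfloor>" for a
  have L: "real (L a) = real N * y $ a" for a
    using N(2)[of a] magic_polytope_bounds(1)[OF y] by (simp add: L_def)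
  have "real (\<Sum>a\<in>incident_edges H v. L a) = real N" for v
    using y by (simp add: L magic_polytope_def flip: sum_distrib_left)
  then have "magic_labeling H N L"
    by (simp only: magic_labeling_def of_nat_eq_iff) blast
  moreover have "L e > 0"
    using L[of e] ye N(1) by (metis mult_pos_pos of_nat_0_less_iff)
  ultimately show "\<exists>r L. magic_labeling H r L \<and> L e > 0"
    by blast
qed

text \<open>\<open>H\<close> is the support of a point \<open>x\<close> of maximal support in
  \<open>F\<close>, so \<open>F\<close> lies in the polytope of \<open>H\<close>. Conversely, a
  segment from any \<open>y\<close> in that polytope to \<open>x\<close> can be prolonged beyond
  \<open>x\<close>, and the face property then puts \<open>y\<close> into \<open>F\<close>.\<close>

lemma face_eq_magic_polytope:
  fixes F :: "(real ^ 'v::finite uprod) set"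
  assumes F: "F face_of magic_polytope UNIV" "F \<noteq> {}"
  obtains H x where "F = magic_polytope H" "x \<in> magic_polytope H" "\<And>e. e \<in> H \<Longrightarrow> x $ e > 0"
proof -
  have sub: "F \<subseteq> magic_polytope UNIV"
    using F by (rule_tac face_of_imp_subset)
  obtain x where x: "x \<in> F" "\<And>L e. L \<in> F \<Longrightarrow> L $ e > 0 \<Longrightarrow> x $ e > 0"
    using convex_ex_maximal_support[of F] F sub magic_polytope_bounds(1)
    by (metis face_of_imp_convex subsetD)
  have xU: "x \<in> magic_polytope UNIV"
    using x sub by auto
  define H where "H = {e. x $ e > 0}"
  have inc: "(\<Sum>e\<in>incident_edges UNIV v. y $ e) = (\<Sum>e\<in>incident_edges H v. y $ e)"
    if "\<And>e. e \<notin> H \<Longrightarrow> y $ e = 0" for v and y :: "real^'v uprod"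
    by (rule sum.mono_neutral_right) (use that in \<open>auto simp: incident_edges_def\<close>)
  have FH: "F \<subseteq> magic_polytope H"
  proof
    fix y assume y: "y \<in> F"
    then have yU: "y \<in> magic_polytope UNIV"
      using sub by auto
    have "y $ e = 0" if "e \<notin> H" for e
      using x(2)[OF y, of e] that magic_polytope_bounds(1)[OF yU, of e]
      by (auto simp: H_def order_less_le)
    then show "y \<in> magic_polytope H"
      using yU inc[of y] by (auto simp: magic_polytope_def)
  qed
  have "magic_polytope H \<subseteq> F"
  proof
    fix y assume y: "y \<in> magic_polytope H"
    then have yU: "y \<in> magic_polytope UNIV"
      using face_of_imp_subset[OF magic_polytope_face] by blast
    show "y \<in> F"
    proof (cases "y = x")
      case False
      have "(x - y) $ e = 0" if "x $ e = 0" for e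
        using y that by (auto simp: magic_polytope_def H_def)
      then obtain \<epsilon> where \<epsilon>: "\<epsilon> > 0" "x + \<epsilon> *\<^sub>R (x - y) \<in> magic_polytope UNIV"
        using magic_polytope_add_kernel[OF xU magic_polytope_diff_kernel[OF xU yU]]
        by (metis abs_of_pos order_refl)
      \<comment> \<open>The weight \<open>?u\<close> comes from solving
        \<open>(1 + \<epsilon>) *\<^sub>R x = ?w + \<epsilon> *\<^sub>R y\<close> for
        \<open>x\<close>.\<close>
      let ?w = "x + \<epsilon> *\<^sub>R (x - y)" and ?u = "1 / (1 + \<epsilon>)"
      have u: "0 < ?u" "?u < 1" "1 - ?u = \<epsilon> * ?u"
        using \<epsilon> by (auto simp: field_simps)
      have "(1 - ?u) *\<^sub>R y + ?u *\<^sub>R ?w = ?u *\<^sub>R ((1 + \<epsilon>) *\<^sub>R x)"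
        unfolding u(3) by (simp add: algebra_simps)
      also have "\<dots> = x"
        using \<epsilon> by simp
      finally have xc: "x = (1 - ?u) *\<^sub>R y + ?u *\<^sub>R ?w" ..
      have "y \<noteq> ?w"
      proof
        assume "y = ?w"
        then have "(1 + \<epsilon>) *\<^sub>R (x - y) = 0"
          by (simp add: algebra_simps)
        then show False using \<epsilon> False by simp
      qed
      then have "x \<in> open_segment y ?w"
        unfolding in_segment using u xc by blast
      then show ?thesis
        using face_ofD[OF F(1)] yU \<epsilon>(2) x(1) by blast
    qed (use x in simp)
  qed
  with FH have "F = magic_polytope H"
    by blast
  moreover have "x \<in> magic_polytope H"
    using x FH by blast
  ultimately show ?thesis
    by (rule that) (simp add: H_def)
qed

section \<open>Dimension and faces for the complete general graph\<close>

lemma incident_edges_UNIV: "incident_edges UNIV v = range (Upair v)"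
proof -
  have "e \<in> range (Upair v)" if "v \<in> set_uprod e" for e
    using that by (cases e) (auto simp: Upair_inject intro: rangeI)
  then show ?thesis
    by (auto simp: incident_edges_def)
qed

lemma inj_on_Upair: "inj_on (Upair v) A"
  by (auto simp: inj_on_def)

text \<open>Every vertex lies on \<open>n\<close> edges, its loop included, so the constant labeling
  \<open>1 / n\<close> is a positive point. The dimension is then the number
  \<open>n * (n + 1) div 2\<close> of edges minus the full rank \<open>n\<close>.\<close>

lemma aff_dim_complete_general:
  defines "n \<equiv> CARD('v::finite)"
  shows "aff_dim (magic_polytope (UNIV :: 'v uprod set)) = int (n * (n - 1) div 2)"
proof -
  let ?x = "(\<chi> e. 1 / real n) :: real^'v uprod"
  have "n > 0"
    by (simp add: n_def)
  moreover have "card (incident_edges UNIV v) = n" for v :: 'v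
    unfolding incident_edges_UNIV n_def by (intro card_image inj_on_Upair)
  ultimately have "?x \<in> magic_polytope UNIV"
    by (simp add: magic_polytope_def)
  then have "aff_dim (magic_polytope (UNIV :: 'v uprod set)) =
      int (dim (magic_kernel (UNIV :: 'v uprod set)))"
    by (rule aff_dim_magic_polytope) (use \<open>n > 0\<close> in simp)
  moreover have "dim (magic_kernel (UNIV :: 'v uprod set)) + n = n * (n + 1) div 2"
    using dim_magic_kernel[of "UNIV :: 'v uprod set"]
    by (simp add: dim_range_star_vector_UNIV card_UNIV_uprod n_def)
  moreover have "n * (n + 1) div 2 = n * (n - 1) div 2 + n"
  proof -
    obtain k where "n = Suc k"
      using \<open>n > 0\<close> gr0_implies_Suc by blast
    then have "n * (n + 1) = n * (n - 1) + n * 2"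
      by simp
    then show ?thesis
      by simp
  qed
  ultimately show ?thesis
    by simp
qed

lemma faces_magic_polytope:
  fixes d :: nat
  shows "{F. F face_of magic_polytope (UNIV :: 'v::finite uprod set) \<and> F \<noteq> {} \<and> aff_dim F = int d} =
    {magic_polytope H |H. positive_graph H \<and> card H \<le> CARD('v) + d \<and>
                          aff_dim (magic_polytope H) = int d}"
proof (intro set_eqI iffI; clarify)
  fix F :: "(real ^ 'v uprod) set"
  assume F: "F face_of magic_polytope UNIV" "F \<noteq> {}" "aff_dim F = int d"
  obtain H x where H: "F = magic_polytope H"
    and x: "x \<in> magic_polytope H" "\<And>e. e \<in> H \<Longrightarrow> x $ e > 0"
    using face_eq_magic_polytope[OF F(1,2)] by blast
  have "positive_graph H"
    by (rule positive_graph_of_positive_point[OF x])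
  \<comment> \<open>The number of edges is \<open>d\<close> plus the rank of the incidence matrix,
    and there is one row per vertex.\<close>
  moreover have "card H \<le> CARD('v) + d"
    using aff_dim_magic_polytope[OF x] dim_magic_kernel[of H] dim_range_star_vector_le[of H] F(3) H
    by simp
  ultimately show "\<exists>H. F = magic_polytope H \<and> positive_graph H \<and> card H \<le> CARD('v) + d \<and>
      aff_dim (magic_polytope H) = int d"
    using F(3) H by blast
next
  fix H :: "'v uprod set"
  assume "aff_dim (magic_polytope H) = int d"
  \<comment> \<open>Nonemptiness follows from the dimension, since the empty set has affine
    dimension -1.\<close>
  then show "magic_polytope H face_of magic_polytope UNIV \<and> magic_polytope H \<noteq> {} \<and>
      aff_dim (magic_polytope H) = int d"
    using magic_polytope_face[of H] by auto
qed

section \<open>Copies of the Birkhoff polytope\<close>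

definition complete_bipartite :: "'v set \<Rightarrow> 'v uprod set" where
  "complete_bipartite A = {Upair a b |a b. a \<in> A \<and> b \<notin> A}"

lemma Upair_in_complete_bipartite:
  "Upair a b \<in> complete_bipartite A \<longleftrightarrow> (a \<in> A \<longleftrightarrow> b \<notin> A)"
  by (auto simp: complete_bipartite_def)

lemma complete_bipartite_Compl: "complete_bipartite (- A) = complete_bipartite A"
proof -
  have "e \<in> complete_bipartite (- A) \<longleftrightarrow> e \<in> complete_bipartite A" for e
    by (cases e) (auto simp: Upair_in_complete_bipartite)
  then show ?thesis by blast
qed

lemma incident_edges_complete_bipartite:
  "incident_edges (complete_bipartite A) v = Upair v ` (if v \<in> A then - A else A)"
proof -
  have "e \<in> incident_edges (complete_bipartite A) v \<longleftrightarrow>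
      e \<in> Upair v ` (if v \<in> A then - A else A)" for e
    by (cases e) (auto simp: incident_edges_def Upair_in_complete_bipartite)
  then show ?thesis by blast
qed

lemma map_uprod_Knn_edges:
  "map_uprod f ` Knn_edges m = {Upair a b |a b. a \<in> f ` Inl ` {..<m} \<and> b \<in> f ` Inr ` {..<m}}"
proof (intro set_eqI iffI)
  fix e assume "e \<in> map_uprod f ` Knn_edges m"
  then show "e \<in> {Upair a b |a b. a \<in> f ` Inl ` {..<m} \<and> b \<in> f ` Inr ` {..<m}}"
    unfolding Knn_edges_def by fastforce
next
  fix e assume "e \<in> {Upair a b |a b. a \<in> f ` Inl ` {..<m} \<and> b \<in> f ` Inr ` {..<m}}"
  then obtain i j where "e = map_uprod f (Upair (Inl i) (Inr j))" "i < m" "j < m"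
    by auto
  then show "e \<in> map_uprod f ` Knn_edges m"
    unfolding Knn_edges_def by blast
qed

text \<open>An isomorphism carries the two sides of the model graph to a half \<open>A\<close> and
  its complement. Conversely, enumerations of both halves glue to an isomorphism.\<close>

lemma birkhoff_copy_iff:
  assumes "CARD('v::finite) = 2 * m"
  shows "birkhoff_copy m F \<longleftrightarrow> (\<exists>A::'v set. card A = m \<and> F = magic_polytope (complete_bipartite A))"
proof
  assume "birkhoff_copy m F"
  then obtain f :: "nat + nat \<Rightarrow> 'v" and H
    where bij: "bij_betw f (Knn_verts m) UNIV" and H: "map_uprod f ` Knn_edges m = H"
      and F: "F = magic_polytope H"
    by (auto simp: birkhoff_copy_def graph_isomorphism_def)
  define A where "A = f ` Inl ` {..<m}"
  have inj: "inj_on f (Knn_verts m)" and sur: "f ` Knn_verts m = UNIV"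
    using bij by (auto simp: bij_betw_def)
  have "inj_on f (Inl ` {..<m})"
    by (rule inj_on_subset[OF inj]) (auto simp: Knn_verts_def)
  then have "card A = m"
    by (simp add: A_def card_image)
  have "- A = f ` (Knn_verts m - Inl ` {..<m})"
    unfolding A_def sur[symmetric] Compl_eq_Diff_UNIV
    by (rule inj_on_image_set_diff[symmetric, OF inj]) (auto simp: Knn_verts_def)
  also have "Knn_verts m - Inl ` {..<m} = Inr ` {..<m}"
    by (auto simp: Knn_verts_def)
  finally have cA: "- A = f ` Inr ` {..<m}" .
  have "complete_bipartite A = {Upair a b |a b. a \<in> A \<and> b \<in> - A}"
    by (simp add: complete_bipartite_def)
  also have "\<dots> = map_uprod f ` Knn_edges m"
    unfolding cA unfolding A_def by (rule map_uprod_Knn_edges[symmetric])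
  finally show "\<exists>A. card A = m \<and> F = magic_polytope (complete_bipartite A)"
    using F H \<open>card A = m\<close> by metis
next
  assume "\<exists>A::'v set. card A = m \<and> F = magic_polytope (complete_bipartite A)"
  then obtain A :: "'v set" where A: "card A = m" "F = magic_polytope (complete_bipartite A)"
    by blast
  have "card (- A) = m"
    using A assms by (simp add: card_Diff_subset Compl_eq_Diff_UNIV)
  then obtain g h where g: "bij_betw g {..<m} A" and h: "bij_betw h {..<m} (- A)"
    using A(1) by (metis ex_bij_betw_nat_finite finite atLeast0LessThan)
  define f where "f = case_sum g h"
  have "bij_betw f (Inl ` {..<m}) A"
    using g by (auto simp: bij_betw_def f_def inj_on_def image_image)
  moreover have "bij_betw f (Inr ` {..<m}) (- A)"
    using h by (auto simp: bij_betw_def f_def inj_on_def image_image)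
  ultimately have "bij_betw f (Knn_verts m) (A \<union> - A)"
    unfolding Knn_verts_def by (rule bij_betw_combine) simp
  moreover have "complete_bipartite A = {Upair a b |a b. a \<in> g ` {..<m} \<and> b \<in> h ` {..<m}}"
    using g h by (simp add: complete_bipartite_def bij_betw_def)
  then have "map_uprod f ` Knn_edges m = complete_bipartite A"
    by (simp add: map_uprod_Knn_edges f_def image_image)
  ultimately show "birkhoff_copy m F"
    using A by (auto simp: birkhoff_copy_def graph_isomorphism_def)
qed

text \<open>This point shows that the face is nonempty, and its support recovers the graph from the
  polytope.\<close>

lemma uniform_in_magic_polytope_complete_bipartite:
  assumes "CARD('v::finite) = 2 * m" "card (A :: 'v set) = m"
  shows "(\<chi> e. if e \<in> complete_bipartite A then 1 / real m else 0)
    \<in> magic_polytope (complete_bipartite A)"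
proof -
  have "m > 0"
    using assms(1) zero_less_card_finite[where 'a = 'v] by simp
  have "card (- A) = m"
    using assms by (simp add: card_Diff_subset Compl_eq_Diff_UNIV)
  then have "card (incident_edges (complete_bipartite A) v) = m" for v
    unfolding incident_edges_complete_bipartite
    using assms by (simp add: card_image inj_on_Upair)
  moreover have "incident_edges (complete_bipartite A) v \<inter> complete_bipartite A =
      incident_edges (complete_bipartite A) v" for v
    by (auto simp: incident_edges_def)
  ultimately show ?thesis
    using \<open>m > 0\<close> by (auto simp: magic_polytope_def sum.If_cases)
qed

text \<open>A half and its complement give the same graph, and exactly one of the two avoids the
  fixed vertex \<open>r\<close>. The faces thus correspond to the \<open>m\<close>-subsets of the
  remaining \<open>2 * m - 1\<close> vertices.\<close>

lemma card_birkhoff_faces: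
  assumes card: "CARD('v::finite) = 2 * m"
  shows "card {F. F face_of magic_polytope (UNIV :: 'v uprod set) \<and> F \<noteq> {} \<and> birkhoff_copy m F}
    = (2 * m - 1) choose m"
proof -
  fix r :: 'v
  let ?S = "{A. A \<subseteq> UNIV - {r} \<and> card A = m}"
  let ?P = "\<lambda>A::'v set. magic_polytope (complete_bipartite A)"
  have "m > 0"
    using card zero_less_card_finite[where 'a = 'v] by simp
  \<comment> \<open>The uniform labeling for \<open>A\<close> lies in the polytope for
    \<open>B\<close>, so its support consists of edges of the graph for \<open>B\<close>.\<close>
  have sub: "complete_bipartite A \<subseteq> complete_bipartite B"
    if "?P A = ?P B" "card A = m" for A B :: "'v set"
  proof
    fix e assume "e \<in> complete_bipartite A"
    let ?x = "(\<chi> e. if e \<in> complete_bipartite A then 1 / real m else 0) :: real^'v uprod"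
    have "?x \<in> ?P B"
      using uniform_in_magic_polytope_complete_bipartite[OF card that(2)] that(1) by simp
    moreover have "?x $ e \<noteq> 0"
      using \<open>e \<in> complete_bipartite A\<close> \<open>m > 0\<close> by simp
    ultimately show "e \<in> complete_bipartite B"
      unfolding magic_polytope_def by blast
  qed
  have inj: "inj_on ?P ?S"
  proof (rule inj_onI)
    fix A B assume AB: "A \<in> ?S" "B \<in> ?S" "?P A = ?P B"
    then have "complete_bipartite A = complete_bipartite B"
      using sub by (metis (mono_tags, lifting) mem_Collect_eq subset_antisym)
    \<comment> \<open>Since \<open>r\<close> is in neither half, \<open>a\<close> lies in a half
      exactly when the edge from \<open>a\<close> to \<open>r\<close> belongs to its graph.\<close>
    then have "a \<in> A \<longleftrightarrow> a \<in> B" for a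
      using AB Upair_in_complete_bipartite[of a r A] Upair_in_complete_bipartite[of a r B] by auto
    then show "A = B" by blast
  qed
  have "{F. F face_of magic_polytope (UNIV :: 'v uprod set) \<and> F \<noteq> {} \<and> birkhoff_copy m F} = ?P ` ?S"
  proof (intro set_eqI iffI)
    fix F assume "F \<in> {F. F face_of magic_polytope (UNIV :: 'v uprod set) \<and> F \<noteq> {} \<and> birkhoff_copy m F}"
    then obtain A :: "'v set" where A: "card A = m" "F = ?P A"
      by (auto simp: birkhoff_copy_iff[OF card])
    have "card (- A) = m"
      using A card by (simp add: card_Diff_subset Compl_eq_Diff_UNIV)
    show "F \<in> ?P ` ?S"
    proof (cases "r \<in> A")
      case True
      then show ?thesis
        using A \<open>card (- A) = m\<close> by (intro image_eqI[of _ _ "- A"]) (auto simp: complete_bipartite_Compl)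
    qed (use A in auto)
  next
    fix F assume "F \<in> ?P ` ?S"
    then obtain A :: "'v set" where A: "card A = m" "F = ?P A"
      by auto
    then show "F \<in> {F. F face_of magic_polytope (UNIV :: 'v uprod set) \<and> F \<noteq> {} \<and> birkhoff_copy m F}"
      using uniform_in_magic_polytope_complete_bipartite[OF card A(1)] magic_polytope_face
      by (auto simp: birkhoff_copy_iff[OF card])
  qed
  then have "card {F. F face_of magic_polytope (UNIV :: 'v uprod set) \<and> F \<noteq> {} \<and> birkhoff_copy m F}
      = card ?S"
    by (simp add: card_image[OF inj])
  also have "\<dots> = card (UNIV - {r}) choose m"
    by (rule n_subsets) simp
  also have "card (UNIV - {r}) = 2 * m - 1"
    using card by (simp add: card_Diff_singleton)
  finally show ?thesis .
qed

section \<open>The explicit system of inequalities, and the conclusion\<close>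

lemma magic_polytope_enumerated:
  fixes v :: "nat \<Rightarrow> 'v::finite"
  assumes v: "bij_betw v {1..n} UNIV"
  shows "magic_polytope (UNIV :: 'v uprod set) =
    {L. (\<forall>i j. 1 \<le> i \<and> i \<le> j \<and> j \<le> n \<longrightarrow> L $ Upair (v i) (v j) \<ge> 0) \<and>
        (\<forall>i\<in>{1..n}. (\<Sum>j=1..i. L $ Upair (v j) (v i)) +
                     (\<Sum>j=i+1..n. L $ Upair (v i) (v j)) = 1)}"
proof -
  have sur: "v ` {1..n} = UNIV"
    using v by (simp add: bij_betw_def)
  have all: "(\<forall>x. Q x) \<longleftrightarrow> (\<forall>i\<in>{1..n}. Q (v i))" for Q
  proof -
    have "(\<forall>x. Q x) \<longleftrightarrow> (\<forall>x\<in>v ` {1..n}. Q x)"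
      unfolding sur by simp
    then show ?thesis by simp
  qed
  have comm: "Upair x y = Upair y x" for x y :: 'v
    by simp
  have star: "(\<Sum>e\<in>incident_edges UNIV (v i). L $ e) =
      (\<Sum>j=1..i. L $ Upair (v j) (v i)) + (\<Sum>j=i+1..n. L $ Upair (v i) (v j))"
    if i: "i \<in> {1..n}" for i and L :: "real ^ 'v uprod"
  proof -
    have "(\<Sum>e\<in>incident_edges UNIV (v i). L $ e) = (\<Sum>x\<in>UNIV. L $ Upair (v i) x)"
      unfolding incident_edges_UNIV by (simp add: sum.reindex inj_on_Upair)
    also have "\<dots> = (\<Sum>j=1..n. L $ Upair (v i) (v j))"
      by (rule sum.reindex_bij_betw[OF v, symmetric])
    \<comment> \<open>The index \<open>j = i\<close> goes to the first block, so the loop is counted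
      once.\<close>
    also have "{1..n} = {1..i} \<union> {i+1..n}"
      using i by auto
    also have "(\<Sum>j\<in>\<dots>. L $ Upair (v i) (v j)) =
        (\<Sum>j=1..i. L $ Upair (v i) (v j)) + (\<Sum>j=i+1..n. L $ Upair (v i) (v j))"
      by (rule sum.union_disjoint) auto
    finally show ?thesis
      by (simp add: comm[of "v i"])
  qed
  have nonneg: "(\<forall>e. L $ e \<ge> 0) \<longleftrightarrow>
      (\<forall>i j. 1 \<le> i \<and> i \<le> j \<and> j \<le> n \<longrightarrow> L $ Upair (v i) (v j) \<ge> 0)" for L :: "real ^ 'v uprod"
  proof (intro iffI allI)
    fix e :: "'v uprod"
    assume L: "\<forall>i j. 1 \<le> i \<and> i \<le> j \<and> j \<le> n \<longrightarrow> L $ Upair (v i) (v j) \<ge> 0"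
    obtain x y where e: "e = Upair x y"
      by (cases e)
    obtain i j where ij: "x = v i" "y = v j" "i \<in> {1..n}" "j \<in> {1..n}"
      using sur by (metis UNIV_I imageE)
    show "L $ e \<ge> 0"
    proof (cases "i \<le> j")
      case True
      then show ?thesis
        using L ij e by simp
    next
      \<comment> \<open>The inequalities are indexed by ordered pairs with \<open>i \<le> j\<close>,
        so here the ends of the unordered edge are swapped.\<close>
      case False
      then have "1 \<le> j \<and> j \<le> i \<and> i \<le> n"
        using ij by auto
      then show ?thesis
        unfolding e ij comm[of "v i" "v j"] by (rule L[rule_format])
    qed
  qed simp
  show ?thesis
    unfolding magic_polytope_def all[of "\<lambda>x. sum _ (incident_edges UNIV x) = 1"]
    using nonneg star by auto
qed

theorem corollary1p5p4p1:
  fixes v :: "nat \<Rightarrow> 'v::finite" and n :: nat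
    and P :: "(real ^ 'v uprod) set"
  assumes v: "bij_betw v {1..n} UNIV"
    and P: "P = magic_polytope complete_general_graph"
  shows
    "DIM(real ^ 'v uprod) = n * (n + 1) div 2 \<and>
     aff_dim P = int (n * (n - 1) div 2) \<and>
     rational_polytope P \<and>
     P = {L. (\<forall>i j. 1 \<le> i \<and> i \<le> j \<and> j \<le> n \<longrightarrow> L $ Upair (v i) (v j) \<ge> 0) \<and>
             (\<forall>i\<in>{1..n}. (\<Sum>j=1..i. L $ Upair (v j) (v i)) +
                          (\<Sum>j=i+1..n. L $ Upair (v i) (v j)) = 1)} \<and>
     (\<forall>d::nat. {F. F face_of P \<and> F \<noteq> {} \<and> aff_dim F = int d} =
        {magic_polytope H |H. positive_graph H \<and> card H \<le> n + d \<and>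
                              aff_dim (magic_polytope H) = int d}) \<and>
     (\<forall>m. n = 2 * m \<longrightarrow>
        card {F. F face_of P \<and> F \<noteq> {} \<and> birkhoff_copy m F} = (2 * m - 1) choose m)"
proof -
  have n: "CARD('v) = n"
    using bij_betw_same_card[OF v] by simp
  show ?thesis
    unfolding P
  proof (intro conjI allI impI)
    show "DIM(real ^ 'v uprod) = n * (n + 1) div 2"
      by (simp add: card_UNIV_uprod n)
    show "aff_dim (magic_polytope (complete_general_graph :: 'v uprod set)) = int (n * (n - 1) div 2)"
      using aff_dim_complete_general[where 'v = 'v] by (simp add: n)
    show "rational_polytope (magic_polytope (complete_general_graph :: 'v uprod set))"
      by (simp add: rational_polytope_def polytope_magic_polytope extreme_point_magic_polytope_Rats)
  next
    fix d :: nat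
    show "{F. F face_of magic_polytope (complete_general_graph :: 'v uprod set) \<and> F \<noteq> {} \<and>
          aff_dim F = int d} =
        {magic_polytope H |H. positive_graph H \<and> card H \<le> n + d \<and>
                              aff_dim (magic_polytope H) = int d}"
      using faces_magic_polytope[where 'v = 'v and d = d] unfolding n .
  next
    fix m assume "n = 2 * m"
    then show "card {F. F face_of magic_polytope (complete_general_graph :: 'v uprod set) \<and>
        F \<noteq> {} \<and> birkhoff_copy m F} = (2 * m - 1) choose m"
      using n by (intro card_birkhoff_faces) simp
  qed (rule magic_polytope_enumerated[OF v])
qed

end
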